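(* Let $X=(X,\varepsilon(X))$ be an exterior space that is regular at infinity. Then (i) $L(X)=\bar L(X)$; (ii) $\check{\pi}_0(X)=\check{\bar\pi}_0(X)$ and $e_0L(X)=\bar e_0\bar L(X)$; (iii) $\check c(X)=\check{\bar c}(X)$ and $eL(X)=\bar e\bar L(X)$. Here the equalities in (ii) and (iii) mean that the canonical natural maps $\check{\pi}_0(X)\to\check{\bar\pi}_0(X)$ and $\check c(X)\to\check{\bar c}(X)$ are homeomorphisms, under which the indicated subsets correspond.
   Context: An externology on a topological space $X$ is a non-empty collection $\varepsilon(X)$ of open subsets closed under finite intersections and such that any open set containing a member of $\varepsilon(X)$ is in $\varepsilon(X)$. An exterior space is a topological space with an externology. It is regular at infinity if for every $E\in\varepsilon(X)$ there is $E'\in\varepsilon(X)$ with $\overline{E'}\subset E$. For a space $Y$, $\pi_0(Y)$ (resp. $c(Y)$) is the set of path-components (resp. connected components) with the quotient topology from $Y$. Regarding $\varepsilon(X)$ and $\{\overline{E}: E\in\varepsilon(X)\}$ as inverse systems under inclusions, define $L(X)=\bigcap_{E\in\varepsilon(X)}E$, $\bar L(X)=\bigcap_{E\in\varepsilon(X)}\overline{E}$ (subspaces of $X$), and the inverse limits in topological spaces $\check{\pi}_0(X)=\lim_{E}\pi_0(E)$, $\check c(X)=\lim_{E}c(E)$, $\check{\bar\pi}_0(X)=\lim_{E}\pi_0(\overline{E})$, $\check{\bar c}(X)=\lim_{E}c(\overline{E})$, $E\in\varepsilon(X)$. The inclusions $E\subset\overline{E}$ induce natural maps $\check{\pi}_0(X)\to\check{\bar\pi}_0(X)$,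 $\check c(X)\to\check{\bar c}(X)$. The maps $e_0:L(X)\to\check{\pi}_0(X)$, $e:L(X)\to\check c(X)$, $\bar e_0:\bar L(X)\to\check{\bar\pi}_0(X)$, $\bar e:\bar L(X)\to\check{\bar c}(X)$ send $p$ to the family of (path-)components of $E$ (resp. $\overline{E}$) containing $p$, and $e_0L(X)$, $eL(X)$, $\bar e_0\bar L(X)$, $\bar e\bar L(X)$ denote their images. *)

theory Defs
  imports "HOL-Analysis.Analysis"
begin

section \<open>Exterior spaces\<close>

text \<open>Closure under binary intersections gives all non-empty finite ones by induction; the empty
  intersection \<^term>\<open>topspace X\<close> belongs to \<open>\<epsilon>\<close> by non-emptiness and upward closure. No member is
  required to be non-empty.\<close>

definition externology :: "'a topology \<Rightarrow> 'a set set \<Rightarrow> bool" where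
  "externology X \<epsilon> \<longleftrightarrow>
     \<epsilon> \<noteq> {} \<and>
     (\<forall>E\<in>\<epsilon>. openin X E) \<and>
     (\<forall>E\<in>\<epsilon>. \<forall>E'\<in>\<epsilon>. E \<inter> E' \<in> \<epsilon>) \<and>
     (\<forall>E\<in>\<epsilon>. \<forall>U. openin X U \<and> E \<subseteq> U \<longrightarrow> U \<in> \<epsilon>)"

definition regular_at_infinity :: "'a topology \<Rightarrow> 'a set set \<Rightarrow> bool" where
  "regular_at_infinity X \<epsilon> \<longleftrightarrow> (\<forall>E\<in>\<epsilon>. \<exists>E'\<in>\<epsilon>. X closure_of E' \<subseteq> E)"

definition limit_set :: "'a set set \<Rightarrow> 'a set" where
  "limit_set \<epsilon> = (\<Inter>E\<in>\<epsilon>. E)"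

definition bar_limit_set :: "'a topology \<Rightarrow> 'a set set \<Rightarrow> 'a set" where
  "bar_limit_set X \<epsilon> = (\<Inter>E\<in>\<epsilon>. X closure_of E)"


section \<open>Quotient topologies and spaces of components\<close>

definition quotient_topology :: "'a topology \<Rightarrow> ('a \<Rightarrow> 'b) \<Rightarrow> 'b topology" where
  "quotient_topology X q =
     topology (\<lambda>U. U \<subseteq> q ` topspace X \<and> openin X {x \<in> topspace X. q x \<in> U})"

lemma openin_quotient_topology:
  "openin (quotient_topology X q) U \<longleftrightarrow>
     U \<subseteq> q ` topspace X \<and> openin X {x \<in> topspace X. q x \<in> U}"
proof -
  have "istopology (\<lambda>U. U \<subseteq> q ` topspace X \<and> openin X {x \<in> topspace X. q x \<in> U})"
    unfolding istopology_def
  proof (intro conjI allI impI)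
    fix S T
    assume S: "S \<subseteq> q ` topspace X \<and> openin X {x \<in> topspace X. q x \<in> S}"
      and T: "T \<subseteq> q ` topspace X \<and> openin X {x \<in> topspace X. q x \<in> T}"
    show "S \<inter> T \<subseteq> q ` topspace X" using S by blast
    have "{x \<in> topspace X. q x \<in> S \<inter> T} =
        {x \<in> topspace X. q x \<in> S} \<inter> {x \<in> topspace X. q x \<in> T}" by blast
    with S T show "openin X {x \<in> topspace X. q x \<in> S \<inter> T}" by auto
  next
    fix K
    assume K: "\<forall>S\<in>K. S \<subseteq> q ` topspace X \<and> openin X {x \<in> topspace X. q x \<in> S}"
    then show "\<Union>K \<subseteq> q ` topspace X" by blast
    have "{x \<in> topspace X. q x \<in> \<Union>K} = (\<Union>S\<in>K. {x \<in> topspace X. q x \<in> S})" by blast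
    moreover have "openin X (\<Union>S\<in>K. {x \<in> topspace X. q x \<in> S})"
      using K by (intro openin_Union) auto
    ultimately show "openin X {x \<in> topspace X. q x \<in> \<Union>K}" by simp
  qed
  then show ?thesis
    unfolding quotient_topology_def by (simp add: topology_inverse')
qed

lemma topspace_quotient_topology: "topspace (quotient_topology X q) = q ` topspace X"
proof -
  have "{x \<in> topspace X. q x \<in> q ` topspace X} = topspace X" by blast
  then have "openin (quotient_topology X q) (q ` topspace X)"
    by (simp add: openin_quotient_topology)
  then show ?thesis
    by (meson openin_quotient_topology openin_subset openin_topspace subset_antisym)
qed

lemma quotient_map_quotient_topology: "quotient_map X (quotient_topology X q) q"
  by (simp add: quotient_map_def topspace_quotient_topology openin_quotient_topology)

definition pi0_space :: "'a topology \<Rightarrow> 'a set topology" where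
  "pi0_space Y = quotient_topology Y (path_component_of_set Y)"

definition comp_space :: "'a topology \<Rightarrow> 'a set topology" where
  "comp_space Y = quotient_topology Y (connected_component_of_set Y)"

lemma topspace_pi0_space: "topspace (pi0_space Y) = path_components_of Y"
  by (simp add: pi0_space_def topspace_quotient_topology path_components_of_def)

lemma topspace_comp_space: "topspace (comp_space Y) = connected_components_of Y"
  by (simp add: comp_space_def topspace_quotient_topology connected_components_of_def)

text \<open>The maps induced on components by an inclusion of a subspace into \<open>Y\<close>: a component \<open>C\<close> of
  the subspace is sent to the component of \<open>Y\<close> containing it. All components in the union below
  coincide (see the two lemmas that follow), so the union is that component, obtained without
  choosing a point of \<open>C\<close>.\<close>

definition pi0_incl :: "'a topology \<Rightarrow> 'a set \<Rightarrow> 'a set" where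
  "pi0_incl Y C = (\<Union>x\<in>C. path_component_of_set Y x)"

definition comp_incl :: "'a topology \<Rightarrow> 'a set \<Rightarrow> 'a set" where
  "comp_incl Y C = (\<Union>x\<in>C. connected_component_of_set Y x)"

lemma pi0_incl_component:
  assumes "A \<subseteq> B" "p \<in> A" "p \<in> topspace X"
  shows "pi0_incl (subtopology X B) (path_component_of_set (subtopology X A) p) =
         path_component_of_set (subtopology X B) p"
proof -
  have mono: "path_component_of (subtopology X B) p x"
    if "path_component_of (subtopology X A) p x" for x
    using that assms(1) unfolding path_component_of_def pathin_def continuous_map_in_subtopology
    by blast
  have refl: "path_component_of (subtopology X A) p p"
    using assms by (simp add: path_component_of_refl)
  show ?thesis
    unfolding pi0_incl_def
    using mono refl by (auto intro: path_component_of_trans)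
qed

lemma comp_incl_component:
  assumes "A \<subseteq> B" "p \<in> A" "p \<in> topspace X"
  shows "comp_incl (subtopology X B) (connected_component_of_set (subtopology X A) p) =
         connected_component_of_set (subtopology X B) p"
proof -
  have mono: "connected_component_of (subtopology X B) p x"
    if "connected_component_of (subtopology X A) p x" for x
    using that assms(1) unfolding connected_component_of_def connectedin_subtopology by blast
  have refl: "connected_component_of (subtopology X A) p p"
    using assms by (simp add: connected_component_of_refl)
  show ?thesis
    unfolding comp_incl_def
    using mono refl by (auto intro: connected_component_of_trans)
qed


section \<open>Inverse limits\<close>

text \<open>Limit in topological spaces of a system \<open>Y i\<close> (\<open>i \<in> I\<close>) with bonding maps
  \<open>f i j : Y i \<rightarrow> Y j\<close> for \<open>le i j\<close>: compatible families, as a subspace of the product.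
  Families are extensional functions on \<open>I\<close>, as in \<^const>\<open>product_topology\<close>.\<close>

definition inverse_limit ::
  "'i set \<Rightarrow> ('i \<Rightarrow> 'i \<Rightarrow> bool) \<Rightarrow> ('i \<Rightarrow> 'b topology) \<Rightarrow> ('i \<Rightarrow> 'i \<Rightarrow> 'b \<Rightarrow> 'b) \<Rightarrow> ('i \<Rightarrow> 'b) topology"
where
  "inverse_limit I le Y f =
     subtopology (product_topology Y I) {x. \<forall>i\<in>I. \<forall>j\<in>I. le i j \<longrightarrow> f i j (x i) = x j}"

text \<open>The four systems are all indexed by the members of \<open>\<epsilon>\<close>, ordered by inclusion.
  For the closures this agrees with indexing by the closed sets themselves: if \<open>E\<close>, \<open>E'\<close> have
  nested closures, compatibility follows by passing through \<open>E \<inter> E' \<in> \<epsilon>\<close>.\<close>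

definition cech_pi0 :: "'a topology \<Rightarrow> 'a set set \<Rightarrow> ('a set \<Rightarrow> 'a set) topology" where
  "cech_pi0 X \<epsilon> =
     inverse_limit \<epsilon> (\<subseteq>) (\<lambda>E. pi0_space (subtopology X E))
       (\<lambda>E E'. pi0_incl (subtopology X E'))"

definition cech_comp :: "'a topology \<Rightarrow> 'a set set \<Rightarrow> ('a set \<Rightarrow> 'a set) topology" where
  "cech_comp X \<epsilon> =
     inverse_limit \<epsilon> (\<subseteq>) (\<lambda>E. comp_space (subtopology X E))
       (\<lambda>E E'. comp_incl (subtopology X E'))"

definition cech_bar_pi0 :: "'a topology \<Rightarrow> 'a set set \<Rightarrow> ('a set \<Rightarrow> 'a set) topology" where
  "cech_bar_pi0 X \<epsilon> =
     inverse_limit \<epsilon> (\<subseteq>) (\<lambda>E. pi0_space (subtopology X (X closure_of E)))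
       (\<lambda>E E'. pi0_incl (subtopology X (X closure_of E')))"

definition cech_bar_comp :: "'a topology \<Rightarrow> 'a set set \<Rightarrow> ('a set \<Rightarrow> 'a set) topology" where
  "cech_bar_comp X \<epsilon> =
     inverse_limit \<epsilon> (\<subseteq>) (\<lambda>E. comp_space (subtopology X (X closure_of E)))
       (\<lambda>E E'. comp_incl (subtopology X (X closure_of E')))"

text \<open>The natural maps induced by the inclusions of \<open>E\<close> into its closure.\<close>

definition nat_pi0 :: "'a topology \<Rightarrow> 'a set set \<Rightarrow> ('a set \<Rightarrow> 'a set) \<Rightarrow> ('a set \<Rightarrow> 'a set)" where
  "nat_pi0 X \<epsilon> x = (\<lambda>E\<in>\<epsilon>. pi0_incl (subtopology X (X closure_of E)) (x E))"

definition nat_comp :: "'a topology \<Rightarrow> 'a set set \<Rightarrow> ('a set \<Rightarrow> 'a set) \<Rightarrow> ('a set \<Rightarrow> 'a set)" where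
  "nat_comp X \<epsilon> x = (\<lambda>E\<in>\<epsilon>. comp_incl (subtopology X (X closure_of E)) (x E))"


section \<open>The maps from the limit sets\<close>

definition e0_map :: "'a topology \<Rightarrow> 'a set set \<Rightarrow> 'a \<Rightarrow> ('a set \<Rightarrow> 'a set)" where
  "e0_map X \<epsilon> p = (\<lambda>E\<in>\<epsilon>. path_component_of_set (subtopology X E) p)"

definition e_map :: "'a topology \<Rightarrow> 'a set set \<Rightarrow> 'a \<Rightarrow> ('a set \<Rightarrow> 'a set)" where
  "e_map X \<epsilon> p = (\<lambda>E\<in>\<epsilon>. connected_component_of_set (subtopology X E) p)"

definition bar_e0_map :: "'a topology \<Rightarrow> 'a set set \<Rightarrow> 'a \<Rightarrow> ('a set \<Rightarrow> 'a set)" where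
  "bar_e0_map X \<epsilon> p = (\<lambda>E\<in>\<epsilon>. path_component_of_set (subtopology X (X closure_of E)) p)"

definition bar_e_map :: "'a topology \<Rightarrow> 'a set set \<Rightarrow> 'a \<Rightarrow> ('a set \<Rightarrow> 'a set)" where
  "bar_e_map X \<epsilon> p = (\<lambda>E\<in>\<epsilon>. connected_component_of_set (subtopology X (X closure_of E)) p)"

end

theory Submission
  imports Defs
begin

text \<open>If \<open>r E \<in> \<epsilon>\<close> satisfies \<open>X closure_of r E \<subseteq> E\<close>, then sending a family \<open>y\<close> to the family of
  components of \<open>E\<close> containing \<open>y (r E)\<close> is inverse to the natural map. The natural map (with
  \<open>r = id\<close>) and this inverse are both instances of one construction, \<open>refine\<close> below, whose value
  does not depend on \<open>r\<close> because compatible families are determined by arbitrarily small members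
  of \<open>\<epsilon>\<close>. Both versions, for path components and for connected components, use only that
  inclusions of subspaces send components to components.\<close>

lemma externology_subset_closure:
  assumes "externology X \<epsilon>" "E \<in> \<epsilon>"
  shows "E \<subseteq> X closure_of E"
proof -
  have "openin X E"
    using assms unfolding externology_def by blast
  then show ?thesis
    by (simp add: closure_of_subset openin_subset)
qed

text \<open>Path components and connected components share this interface. Continuity of the induced
  maps is derived from it through the quotient topology.\<close>

locale component_functor =
  fixes comp :: "'a topology \<Rightarrow> 'a \<Rightarrow> 'a set"
    and space :: "'a topology \<Rightarrow> 'a set topology"
    and incl :: "'a topology \<Rightarrow> 'a set \<Rightarrow> 'a set"
  assumes space_eq: "space Y = quotient_topology Y (comp Y)"
    and incl_comp: "\<lbrakk>A \<subseteq> B; p \<in> A; p \<in> topspace X\<rbrakk> \<Longrightarrow>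
      incl (subtopology X B) (comp (subtopology X A) p) = comp (subtopology X B) p"
begin

lemma quotient_map_comp: "quotient_map Y (space Y) (comp Y)"
  by (simp add: space_eq quotient_map_quotient_topology)

lemma space_cases:
  assumes "C \<in> topspace (space (subtopology X A))"
  obtains p where "p \<in> A" "p \<in> topspace X" "C = comp (subtopology X A) p"
  using assms by (auto simp: space_eq topspace_quotient_topology)

text \<open>A point of the component space is the component of some \<open>p\<close> in
  \<open>A\<close>, and by \<open>incl_comp\<close> both sides become the component of that
  \<open>p\<close> in \<open>B\<close>.\<close>

lemma incl_incl:
  assumes "C \<in> topspace (space (subtopology X A))" "A \<subseteq> A'" "A' \<subseteq> B"
  shows "incl (subtopology X B) (incl (subtopology X A') C) = incl (subtopology X B) C"
proof -
  obtain p where "p \<in> A" "p \<in> topspace X" "C = comp (subtopology X A) p"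
    using assms(1) by (rule space_cases)
  with assms(2,3) show ?thesis
    by (simp add: incl_comp subset_iff)
qed

text \<open>Universal property of the quotient: composed with the quotient map of \<open>A\<close>,
  \<open>incl\<close> becomes the quotient map of \<open>B\<close> restricted to \<open>A\<close>,
  which is continuous.\<close>

lemma continuous_map_incl:
  assumes "A \<subseteq> B"
  shows "continuous_map (space (subtopology X A)) (space (subtopology X B))
           (incl (subtopology X B))"
proof -
  have "continuous_map (subtopology X A) (space (subtopology X B)) (comp (subtopology X B))"
    by (metis assms continuous_map_from_subtopology_mono quotient_imp_continuous_map
        quotient_map_comp)
  then have "continuous_map (subtopology X A) (space (subtopology X B))
      (incl (subtopology X B) \<circ> comp (subtopology X A))"
    by (rule continuous_map_eq) (use assms in \<open>auto simp: incl_comp\<close>)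
  then show ?thesis
    using continuous_compose_quotient_map_eq[OF quotient_map_comp] by blast
qed

text \<open>The parameter \<open>A\<close> turns an index \<open>E\<close> into the subspace whose
  components are taken: the identity gives the limits over the members of \<epsilon>, closure gives
  the barred ones.\<close>

definition component_limit :: "'a topology \<Rightarrow> 'a set set \<Rightarrow> ('a set \<Rightarrow> 'a set) \<Rightarrow> ('a set \<Rightarrow> 'a set) topology"
  where "component_limit X \<epsilon> A =
    inverse_limit \<epsilon> (\<subseteq>) (\<lambda>E. space (subtopology X (A E))) (\<lambda>E E'. incl (subtopology X (A E')))"

definition refine ::
  "'a topology \<Rightarrow> 'a set set \<Rightarrow> ('a set \<Rightarrow> 'a set) \<Rightarrow> ('a set \<Rightarrow> 'a set) \<Rightarrow> ('a set \<Rightarrow> 'a set) \<Rightarrow> 'a set \<Rightarrow> 'a set"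
  where "refine X \<epsilon> B r x = (\<lambda>E\<in>\<epsilon>. incl (subtopology X (B E)) (x (r E)))"

lemma topspace_component_limit:
  "x \<in> topspace (component_limit X \<epsilon> A) \<longleftrightarrow>
     x \<in> extensional \<epsilon> \<and> (\<forall>E\<in>\<epsilon>. x E \<in> topspace (space (subtopology X (A E)))) \<and>
     (\<forall>E\<in>\<epsilon>. \<forall>E'\<in>\<epsilon>. E \<subseteq> E' \<longrightarrow> incl (subtopology X (A E')) (x E) = x E')"
  by (auto simp: component_limit_def inverse_limit_def PiE_iff)

text \<open>Each coordinate of \<open>refine\<close> is a projection followed by an
  \<open>incl\<close>, hence continuous; what remains is that its values are compatible
  families.\<close>

lemma continuous_map_refine:
  assumes inter: "\<And>E E'. \<lbrakk>E \<in> \<epsilon>; E' \<in> \<epsilon>\<rbrakk> \<Longrightarrow> E \<inter> E' \<in> \<epsilon>"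
    and monoA: "\<And>E E'. E \<subseteq> E' \<Longrightarrow> A E \<subseteq> A E'"
    and monoB: "\<And>E E'. E \<subseteq> E' \<Longrightarrow> B E \<subseteq> B E'"
    and r: "\<And>E. E \<in> \<epsilon> \<Longrightarrow> r E \<in> \<epsilon>" "\<And>E. E \<in> \<epsilon> \<Longrightarrow> A (r E) \<subseteq> B E"
  shows "continuous_map (component_limit X \<epsilon> A) (component_limit X \<epsilon> B) (refine X \<epsilon> B r)"
proof -
  have "continuous_map (component_limit X \<epsilon> A) (space (subtopology X (B E)))
      (\<lambda>x. refine X \<epsilon> B r x E)" if E: "E \<in> \<epsilon>" for E
  proof -
    have "continuous_map (component_limit X \<epsilon> A) (space (subtopology X (A (r E)))) (\<lambda>x. x (r E))"
      unfolding component_limit_def inverse_limit_def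
      using r(1)[OF E]
      by (intro continuous_map_from_subtopology continuous_map_product_projection)
    then have "continuous_map (component_limit X \<epsilon> A) (space (subtopology X (B E)))
        (incl (subtopology X (B E)) \<circ> (\<lambda>x. x (r E)))"
      using continuous_map_incl[OF r(2)[OF E]] by (rule continuous_map_compose)
    then show ?thesis
      using E by (simp add: refine_def o_def)
  qed
  moreover have "incl (subtopology X (B E')) (refine X \<epsilon> B r x E) = refine X \<epsilon> B r x E'"
    if x: "x \<in> topspace (component_limit X \<epsilon> A)" and E: "E \<in> \<epsilon>" "E' \<in> \<epsilon>" "E \<subseteq> E'" for x E E'
  proof -
    \<comment> \<open>Since \<open>r\<close> need not be monotone, \<open>r E\<close> and
      \<open>r E'\<close> may be incomparable. Both coordinates of \<open>x\<close> are images of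
      its coordinate at the intersection, and the two routes from there into \<open>B E'\<close>
      agree.\<close>
    let ?k = "r E \<inter> r E'"
    have k: "?k \<in> \<epsilon>" using E r(1) inter by blast
    have sub: "A ?k \<subseteq> A (r E)" "A ?k \<subseteq> A (r E')" "A (r E') \<subseteq> B E'"
      "A (r E) \<subseteq> B E" "B E \<subseteq> B E'"
      using E r(2) monoB by (simp_all add: monoA)
    then have sub': "A (r E) \<subseteq> B E'" by blast
    have xs: "x E \<in> topspace (space (subtopology X (A E)))" if "E \<in> \<epsilon>" for E
      using x that by (simp add: topspace_component_limit)
    have x1: "x (r E) = incl (subtopology X (A (r E))) (x ?k)"
      and x2: "x (r E') = incl (subtopology X (A (r E'))) (x ?k)"
      using x k E r(1) by (simp_all add: topspace_component_limit)
    have "incl (subtopology X (B E')) (incl (subtopology X (B E)) (x (r E))) =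
        incl (subtopology X (B E')) (x (r E))"
      by (rule incl_incl[OF xs[OF r(1)[OF E(1)]] sub(4,5)])
    also have "\<dots> = incl (subtopology X (B E')) (x ?k)"
      unfolding x1 by (rule incl_incl[OF xs[OF k] sub(1) sub'])
    also have "\<dots> = incl (subtopology X (B E')) (x (r E'))"
      unfolding x2 by (rule incl_incl[OF xs[OF k] sub(2,3), symmetric])
    finally show ?thesis using E by (simp add: refine_def)
  qed
  ultimately show ?thesis
    unfolding component_limit_def[of X \<epsilon> B] inverse_limit_def
    by (auto simp: continuous_map_in_subtopology continuous_map_componentwise refine_def)
qed

lemma refine_refine:
  assumes x: "x \<in> topspace (component_limit X \<epsilon> A)"
    and r: "\<And>E. E \<in> \<epsilon> \<Longrightarrow> r E \<in> \<epsilon>" "\<And>E. E \<in> \<epsilon> \<Longrightarrow> A (r E) \<subseteq> B E"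
    and s: "\<And>E. E \<in> \<epsilon> \<Longrightarrow> s E \<in> \<epsilon>" "\<And>E. E \<in> \<epsilon> \<Longrightarrow> B (s E) \<subseteq> A E"
    and rs: "\<And>E. E \<in> \<epsilon> \<Longrightarrow> r (s E) \<subseteq> E"
  shows "refine X \<epsilon> A s (refine X \<epsilon> B r x) = x"
proof (rule extensionalityI[where A = \<epsilon>])
  show "refine X \<epsilon> A s (refine X \<epsilon> B r x) \<in> extensional \<epsilon>"
    by (simp add: refine_def)
  show "x \<in> extensional \<epsilon>"
    using x by (simp add: topspace_component_limit)
  fix E assume E: "E \<in> \<epsilon>"
  have "incl (subtopology X (A E)) (incl (subtopology X (B (s E))) (x (r (s E)))) =
      incl (subtopology X (A E)) (x (r (s E)))"
    using x E r s by (intro incl_incl[where A = "A (r (s E))"]) (auto simp: topspace_component_limit)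
  also have "\<dots> = x E"
    using x E r s rs by (simp add: topspace_component_limit)
  finally show "refine X \<epsilon> A s (refine X \<epsilon> B r x) E = x E"
    using E s by (simp add: refine_def)
qed

lemma homeomorphic_map_closure:
  assumes ext: "externology X \<epsilon>" and reg: "regular_at_infinity X \<epsilon>"
  shows "homeomorphic_map (component_limit X \<epsilon> (\<lambda>E. E)) (component_limit X \<epsilon> ((closure_of) X))
           (refine X \<epsilon> ((closure_of) X) (\<lambda>E. E))"
proof -
  \<comment> \<open>Regularity at infinity with choice gives the index shift \<open>s\<close> for
    the inverse.\<close>
  obtain s where s: "\<And>E. E \<in> \<epsilon> \<Longrightarrow> s E \<in> \<epsilon>" "\<And>E. E \<in> \<epsilon> \<Longrightarrow> X closure_of s E \<subseteq> E"
    using bchoice[OF reg[unfolded regular_at_infinity_def Bex_def]] by blast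
  have inter: "\<And>E E'. \<lbrakk>E \<in> \<epsilon>; E' \<in> \<epsilon>\<rbrakk> \<Longrightarrow> E \<inter> E' \<in> \<epsilon>"
    using ext unfolding externology_def by blast
  have cl: "E \<subseteq> X closure_of E" if "E \<in> \<epsilon>" for E
    using externology_subset_closure[OF ext that] .
  \<comment> \<open>In either order one of the two shifts is the identity, so this inclusion is the
    index condition \<open>rs\<close> of \<open>refine_refine\<close> for both composites.\<close>
  have sE: "s E \<subseteq> E" if "E \<in> \<epsilon>" for E
    using cl[OF s(1)[OF that]] s(2)[OF that] by (rule subset_trans)
  have "continuous_map (component_limit X \<epsilon> (\<lambda>E. E)) (component_limit X \<epsilon> ((closure_of) X))
      (refine X \<epsilon> ((closure_of) X) (\<lambda>E. E))"
    by (rule continuous_map_refine) (simp_all add: inter cl closure_of_mono)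
  moreover have "continuous_map (component_limit X \<epsilon> ((closure_of) X)) (component_limit X \<epsilon> (\<lambda>E. E))
      (refine X \<epsilon> (\<lambda>E. E) s)"
    by (rule continuous_map_refine) (simp_all add: inter s closure_of_mono)
  moreover have "refine X \<epsilon> (\<lambda>E. E) s (refine X \<epsilon> ((closure_of) X) (\<lambda>E. E) x) = x"
    if "x \<in> topspace (component_limit X \<epsilon> (\<lambda>E. E))" for x
    by (rule refine_refine[OF that]) (simp_all add: cl s sE)
  moreover have "refine X \<epsilon> ((closure_of) X) (\<lambda>E. E) (refine X \<epsilon> (\<lambda>E. E) s y) = y"
    if "y \<in> topspace (component_limit X \<epsilon> ((closure_of) X))" for y
    by (rule refine_refine[OF that]) (simp_all add: cl s sE)
  ultimately have "homeomorphic_maps (component_limit X \<epsilon> (\<lambda>E. E)) (component_limit X \<epsilon> ((closure_of) X))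
      (refine X \<epsilon> ((closure_of) X) (\<lambda>E. E)) (refine X \<epsilon> (\<lambda>E. E) s)"
    by (simp add: homeomorphic_maps_def)
  then show ?thesis
    by (rule homeomorphic_maps_map[THEN iffD1, THEN conjunct1])
qed

text \<open>This makes the natural map carry the family of a point of the limit set to its barred
  family, which gives the correspondence of images.\<close>

lemma refine_comp:
  assumes "externology X \<epsilon>" "p \<in> limit_set \<epsilon>"
  shows "refine X \<epsilon> ((closure_of) X) (\<lambda>E. E) (\<lambda>E\<in>\<epsilon>. comp (subtopology X E) p) =
         (\<lambda>E\<in>\<epsilon>. comp (subtopology X (X closure_of E)) p)"
  unfolding refine_def
proof (rule restrict_ext)
  fix E assume E: "E \<in> \<epsilon>"
  then have "E \<subseteq> X closure_of E" "p \<in> E"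
    using assms by (auto simp: externology_subset_closure limit_set_def)
  moreover from this have "p \<in> topspace X"
    using closure_of_subset_topspace by fastforce
  ultimately have "incl (subtopology X (X closure_of E)) (comp (subtopology X E) p) =
      comp (subtopology X (X closure_of E)) p"
    by (rule incl_comp)
  then show "incl (subtopology X (X closure_of E)) ((\<lambda>E\<in>\<epsilon>. comp (subtopology X E) p) E) =
      comp (subtopology X (X closure_of E)) p"
    using E by simp
qed

end

interpretation pi0: component_functor path_component_of_set pi0_space pi0_incl
  by standard (simp_all add: pi0_space_def pi0_incl_component)

interpretation conn: component_functor connected_component_of_set comp_space comp_incl
  by standard (simp_all add: comp_space_def comp_incl_component)

lemma limit_set_eq_bar_limit_set:
  assumes "externology X \<epsilon>" "regular_at_infinity X \<epsilon>"
  shows "limit_set \<epsilon> = bar_limit_set X \<epsilon>"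
proof
  show "limit_set \<epsilon> \<subseteq> bar_limit_set X \<epsilon>"
    unfolding limit_set_def bar_limit_set_def
    using externology_subset_closure[OF assms(1)] by blast
  \<comment> \<open>Each \<open>E\<close> contains the closure of some member, and that closure
    contains the intersection of all closures.\<close>
  show "bar_limit_set X \<epsilon> \<subseteq> limit_set \<epsilon>"
    using assms(2) unfolding limit_set_def bar_limit_set_def regular_at_infinity_def by blast
qed

theorem proposition3p14:
  fixes X :: "'a topology" and \<epsilon> :: "'a set set"
  assumes "externology X \<epsilon>"
    and "regular_at_infinity X \<epsilon>"
  shows "limit_set \<epsilon> = bar_limit_set X \<epsilon>
    \<and> (homeomorphic_map (cech_pi0 X \<epsilon>) (cech_bar_pi0 X \<epsilon>) (nat_pi0 X \<epsilon>)
       \<and> nat_pi0 X \<epsilon> ` (e0_map X \<epsilon> ` limit_set \<epsilon>) = bar_e0_map X \<epsilon> ` bar_limit_set X \<epsilon>)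
    \<and> (homeomorphic_map (cech_comp X \<epsilon>) (cech_bar_comp X \<epsilon>) (nat_comp X \<epsilon>)
       \<and> nat_comp X \<epsilon> ` (e_map X \<epsilon> ` limit_set \<epsilon>) = bar_e_map X \<epsilon> ` bar_limit_set X \<epsilon>)"
proof (intro conjI)
  have nat_pi0: "nat_pi0 X \<epsilon> = pi0.refine X \<epsilon> ((closure_of) X) (\<lambda>E. E)"
    by (simp add: fun_eq_iff nat_pi0_def pi0.refine_def)
  have nat_comp: "nat_comp X \<epsilon> = conn.refine X \<epsilon> ((closure_of) X) (\<lambda>E. E)"
    by (simp add: fun_eq_iff nat_comp_def conn.refine_def)
  show L: "limit_set \<epsilon> = bar_limit_set X \<epsilon>"
    using assms by (rule limit_set_eq_bar_limit_set)
  show "homeomorphic_map (cech_pi0 X \<epsilon>) (cech_bar_pi0 X \<epsilon>) (nat_pi0 X \<epsilon>)"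
    using pi0.homeomorphic_map_closure[OF assms]
    by (simp add: nat_pi0 pi0.component_limit_def cech_pi0_def cech_bar_pi0_def)
  show "homeomorphic_map (cech_comp X \<epsilon>) (cech_bar_comp X \<epsilon>) (nat_comp X \<epsilon>)"
    using conn.homeomorphic_map_closure[OF assms]
    by (simp add: nat_comp conn.component_limit_def cech_comp_def cech_bar_comp_def)
  show "nat_pi0 X \<epsilon> ` (e0_map X \<epsilon> ` limit_set \<epsilon>) = bar_e0_map X \<epsilon> ` bar_limit_set X \<epsilon>"
    \<comment> \<open>With both images taken over \<open>limit_set \<epsilon>\<close>, the pointwise
      equality from \<open>refine_comp\<close> suffices.\<close>
    unfolding L[symmetric] image_image
    by (rule image_cong)
      (simp_all add: nat_pi0 e0_map_def bar_e0_map_def pi0.refine_comp[OF assms(1)])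
  show "nat_comp X \<epsilon> ` (e_map X \<epsilon> ` limit_set \<epsilon>) = bar_e_map X \<epsilon> ` bar_limit_set X \<epsilon>"
    unfolding L[symmetric] image_image
    by (rule image_cong)
      (simp_all add: nat_comp e_map_def bar_e_map_def conn.refine_comp[OF assms(1)])
qed

end
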